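(* Let $X$ be a distance-regular graph of diameter $d\geq 2$ with intersection numbers $b_i,c_i$. Let $0\leq j\leq d-2$, assume $b_j>c_{j+1}$, and put $C=b_j/c_{j+1}$. Then for every $1\leq s\leq j+1$, $$b_{j+1}\left(\sum_{t=1}^{s}\frac{1}{b_{t-1}}+\sum_{t=1}^{j+2-s}\frac{1}{b_{t-1}}\right)+c_{j+2}\sum_{t=1}^{j+1}\frac{1}{b_{t-1}}\geq 1-\frac{4}{C-1}.$$
   Context: A connected graph $X$ of diameter $d$ is distance-regular if there are integers $a_i,b_i,c_i$ ($0\le i\le d$) such that for all vertices $v,w$ with $\mathrm{dist}(v,w)=i$, the vertex $w$ has exactly $c_i$ neighbours at distance $i-1$ from $v$, $a_i$ neighbours at distance $i$ from $v$, and $b_i$ neighbours at distance $i+1$ from $v$. Then $X$ is $k$-regular with $k=b_0$, $c_0=b_d=0$, $c_1=1$ and $a_i+b_i+c_i=k$. *)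

theory Defs
  imports Complex_Main
begin

definition simple_graph :: "'a set \<Rightarrow> ('a \<Rightarrow> 'a \<Rightarrow> bool) \<Rightarrow> bool" where
  "simple_graph V E \<longleftrightarrow>
     (\<forall>x y. E x y \<longrightarrow> x \<in> V \<and> y \<in> V) \<and>
     (\<forall>x y. E x y \<longrightarrow> E y x) \<and> (\<forall>x. \<not> E x x)"

fun walk :: "('a \<Rightarrow> 'a \<Rightarrow> bool) \<Rightarrow> nat \<Rightarrow> 'a \<Rightarrow> 'a \<Rightarrow> bool" where
  "walk E 0 v w = (v = w)"
| "walk E (Suc n) v w = (\<exists>u. E v u \<and> walk E n u w)"

definition gdist :: "('a \<Rightarrow> 'a \<Rightarrow> bool) \<Rightarrow> 'a \<Rightarrow> 'a \<Rightarrow> nat" where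
  "gdist E v w = (LEAST n. walk E n v w)"

definition connected_graph :: "'a set \<Rightarrow> ('a \<Rightarrow> 'a \<Rightarrow> bool) \<Rightarrow> bool" where
  "connected_graph V E \<longleftrightarrow> (\<forall>v\<in>V. \<forall>w\<in>V. \<exists>n. walk E n v w)"

definition has_diameter :: "'a set \<Rightarrow> ('a \<Rightarrow> 'a \<Rightarrow> bool) \<Rightarrow> nat \<Rightarrow> bool" where
  "has_diameter V E d \<longleftrightarrow>
     (\<forall>v\<in>V. \<forall>w\<in>V. gdist E v w \<le> d) \<and> (\<exists>v\<in>V. \<exists>w\<in>V. gdist E v w = d)"

definition distance_regular ::
  "'a set \<Rightarrow> ('a \<Rightarrow> 'a \<Rightarrow> bool) \<Rightarrow> nat \<Rightarrow> (nat \<Rightarrow> nat) \<Rightarrow> (nat \<Rightarrow> nat) \<Rightarrow> (nat \<Rightarrow> nat) \<Rightarrow> bool" where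
  "distance_regular V E d a b c \<longleftrightarrow>
     simple_graph V E \<and> finite V \<and> V \<noteq> {} \<and> connected_graph V E \<and> has_diameter V E d \<and>
     (\<forall>i\<le>d. \<forall>v\<in>V. \<forall>w\<in>V. gdist E v w = i \<longrightarrow>
        card {u. E w u \<and> gdist E v u + 1 = i} = c i \<and>
        card {u. E w u \<and> gdist E v u = i} = a i \<and>
        card {u. E w u \<and> gdist E v u = i + 1} = b i)"

end

theory Submission
  imports Defs
begin

text \<open>Put \<open>m = j + 1\<close>. Let \<open>x\<close> move away from a vertex along a random geodesic. The step from
  distance \<open>t - 1\<close> to distance \<open>t\<close> has \<open>b (t - 1)\<close> equally likely outcomes, and at most \<open>b m\<close>
  (respectively \<open>c (m + 1)\<close>) of them carry \<open>x\<close> out of (respectively into) a given ball of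
  radius \<open>m\<close>. So the probability of such a crossing within \<open>s\<close> steps is at most \<open>b m\<close>
  (respectively \<open>c (m + 1)\<close>) times \<open>\<Sum>t = 1..s. 1 / b (t - 1)\<close>.

  Now fix \<open>u\<close> and take \<open>v\<close>, \<open>w\<close> at distances \<open>s\<close> and \<open>m + 1 - s\<close> from \<open>u\<close> and at distance
  \<open>m + 1\<close> from each other. By the first estimate, for an average such pair most of the sphere of
  radius \<open>m\<close> about \<open>u\<close> lies in both balls of radius \<open>m\<close> about \<open>v\<close> and \<open>w\<close>; by the second
  estimate few vertices of the sphere of radius \<open>m\<close> about \<open>v\<close> lie in the ball about \<open>w\<close>. The
  smaller spheres about \<open>v\<close> are negligible, because sphere sizes grow at least by the factor
  \<open>C\<close> up to radius \<open>m\<close>.\<close>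

lemma sum_le_of_geometric_growth:
  fixes f :: "nat \<Rightarrow> 'a :: linordered_idom"
  assumes "\<And>l. l < n \<Longrightarrow> q * f l \<le> f (Suc l)"
  shows "(q - 1) * (\<Sum>l<n. f l) \<le> f n - f 0"
proof -
  have "(q - 1) * (\<Sum>l<n. f l) \<le> (\<Sum>l<n. f (Suc l) - f l)"
    unfolding sum_distrib_left using assms by (intro sum_mono) (simp add: algebra_simps)
  then show ?thesis by (simp add: sum_lessThan_telescope)
qed

lemma ex_le_average_of_biregular:
  fixes f :: "'a \<Rightarrow> real" and g :: "'b \<Rightarrow> real" and \<alpha> \<beta> :: real
  assumes "finite A" "finite B" "A \<noteq> {}" "0 < p"
    and right_degree: "\<And>x. x \<in> A \<Longrightarrow> real (card {y \<in> B. R x y}) = p"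
    and left_degree: "\<And>y. y \<in> B \<Longrightarrow> real (card {x \<in> A. R x y}) = q"
    and f_average: "(\<Sum>x\<in>A. f x) \<le> card A * \<alpha>"
    and g_average: "(\<Sum>y\<in>B. g y) \<le> card B * \<beta>"
  shows "\<exists>x\<in>A. \<exists>y\<in>B. R x y \<and> f x + g y \<le> \<alpha> + \<beta>"
proof (rule ccontr)
  assume "\<not> ?thesis"
  then have above: "0 < (f x - \<alpha>) + (g y - \<beta>)" if "x \<in> A" "y \<in> B" "R x y" for x y
    using that by (force simp: not_le)
  have "{y \<in> B. R x y} \<noteq> {}" if "x \<in> A" for x
    using right_degree[OF that] \<open>0 < p\<close> by (metis card.empty less_irrefl of_nat_0)
  then have "0 < (\<Sum>x\<in>A. \<Sum>y\<in>{y \<in> B. R x y}. (f x - \<alpha>) + (g y - \<beta>))"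
    using assms(1-3) above by (intro sum_pos) auto
  also have "\<dots> = (\<Sum>x\<in>A. p * (f x - \<alpha>)) + (\<Sum>x\<in>A. \<Sum>y\<in>{y \<in> B. R x y}. g y - \<beta>)"
    using right_degree by (simp add: sum.distrib)
  also have "(\<Sum>x\<in>A. \<Sum>y\<in>{y \<in> B. R x y}. g y - \<beta>) = (\<Sum>y\<in>B. q * (g y - \<beta>))"
    using assms(1,2) left_degree by (subst sum.swap_restrict) auto
  also have "(\<Sum>x\<in>A. p * (f x - \<alpha>)) + (\<Sum>y\<in>B. q * (g y - \<beta>))
      = p * (\<Sum>x\<in>A. f x - \<alpha>) + q * (\<Sum>y\<in>B. g y - \<beta>)"
    by (simp add: sum_distrib_left)
  also have "\<dots> \<le> 0"
  proof (intro add_nonpos_nonpos)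
    show "p * (\<Sum>x\<in>A. f x - \<alpha>) \<le> 0"
      using \<open>0 < p\<close> f_average by (simp add: mult_nonneg_nonpos sum_subtractf)
    show "q * (\<Sum>y\<in>B. g y - \<beta>) \<le> 0"
    proof (cases "B = {}")
      case False
      then have "0 \<le> q" using left_degree by force
      then show ?thesis using g_average by (simp add: mult_nonneg_nonpos sum_subtractf)
    qed simp
  qed
  finally show False by simp
qed

lemma walk_add: "walk E (m + n) x z \<longleftrightarrow> (\<exists>y. walk E m x y \<and> walk E n y z)"
  by (induction m arbitrary: x) auto

lemma gdist_le_walk: "walk E n x y \<Longrightarrow> gdist E x y \<le> n"
  unfolding gdist_def by (rule Least_le)

locale connected_simple_graph =
  fixes V :: "'a set" and E :: "'a \<Rightarrow> 'a \<Rightarrow> bool"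
  assumes simple: "simple_graph V E" and connected: "connected_graph V E"
begin

abbreviation dist :: "'a \<Rightarrow> 'a \<Rightarrow> nat" where
  "dist \<equiv> gdist E"

definition sphere :: "'a \<Rightarrow> nat \<Rightarrow> 'a set" where
  "sphere v i = {w \<in> V. dist v w = i}"

definition ball :: "'a \<Rightarrow> nat \<Rightarrow> 'a set" where
  "ball v r = {w \<in> V. dist v w \<le> r}"

definition nbrs :: "'a \<Rightarrow> 'a set" where
  "nbrs v = {w. E v w}"

lemma mem_sphere [simp]: "w \<in> sphere v i \<longleftrightarrow> w \<in> V \<and> dist v w = i"
  and mem_ball [simp]: "w \<in> ball v r \<longleftrightarrow> w \<in> V \<and> dist v w \<le> r"
  and mem_nbrs [simp]: "w \<in> nbrs v \<longleftrightarrow> E v w"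
  by (simp_all add: sphere_def ball_def nbrs_def)

lemma edge_sym: "E x y \<Longrightarrow> E y x"
  and edge_in_V: "E x y \<Longrightarrow> x \<in> V \<and> y \<in> V"
  using simple by (auto simp: simple_graph_def)

lemma walk_sym: "walk E n x y \<Longrightarrow> walk E n y x"
proof (induction n arbitrary: x)
  case (Suc n)
  then obtain u where "E x u" "walk E n u y" by auto
  then have "walk E (n + 1) y x"
    unfolding walk_add using Suc.IH edge_sym by auto
  then show ?case by simp
qed auto

lemma walk_in_V: "walk E n x y \<Longrightarrow> x \<in> V \<Longrightarrow> y \<in> V"
  by (induction n arbitrary: x) (use edge_in_V in auto)

lemma walk_dist: "x \<in> V \<Longrightarrow> y \<in> V \<Longrightarrow> walk E (dist x y) x y"
  using connected unfolding connected_graph_def gdist_def by (meson LeastI_ex)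

lemma dist_sym: "dist x y = dist y x"
  unfolding gdist_def using walk_sym by metis

lemma dist_eq_0: "x \<in> V \<Longrightarrow> y \<in> V \<Longrightarrow> dist x y = 0 \<longleftrightarrow> x = y"
  using walk_dist[of x y] gdist_le_walk[of E 0 x y] by auto

lemma sphere_0: "v \<in> V \<Longrightarrow> sphere v 0 = {v}"
  by (auto simp: dist_eq_0)

lemma dist_triangle:
  assumes "x \<in> V" "y \<in> V" "z \<in> V"
  shows "dist x z \<le> dist x y + dist y z"
  using assms by (intro gdist_le_walk) (auto simp: walk_add intro: walk_dist)

lemma dist_edge_le: "v \<in> V \<Longrightarrow> E w u \<Longrightarrow> dist v u \<le> Suc (dist v w)"
  using dist_triangle[of v w u] gdist_le_walk[of E 1 w u] edge_in_V[of w u] by auto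

lemma edge_if_dist_eq_1: "x \<in> V \<Longrightarrow> y \<in> V \<Longrightarrow> dist x y = 1 \<Longrightarrow> E x y"
  using walk_dist[of x y] by auto

lemma geodesic_point:
  assumes "x \<in> V" "y \<in> V" "dist x y = s + t"
  obtains u where "u \<in> V" "dist x u = s" "dist u y = t"
proof -
  obtain u where u: "walk E s x u" "walk E t u y"
    using walk_dist[OF assms(1,2)] assms(3) by (auto simp: walk_add)
  then have "u \<in> V" "dist x u \<le> s" "dist u y \<le> t"
    using assms walk_in_V by (auto intro: gdist_le_walk)
  then show ?thesis
    using dist_triangle[of x u y] assms by (intro that[of u]) auto
qed

lemma sum_card_nbrs_swap:
  assumes "finite A" "finite B"
  shows "(\<Sum>x\<in>A. card (nbrs x \<inter> B)) = (\<Sum>y\<in>B. card (nbrs y \<inter> A))"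
proof -
  have "nbrs x \<inter> B = {y \<in> B. E x y}" "nbrs x \<inter> A = {y \<in> A. E y x}" for x
    using edge_sym by auto
  then show ?thesis
    using sum_multicount_gen[of A B E "\<lambda>y. card (nbrs y \<inter> A)"] assms by simp
qed

end

locale distance_regular_graph =
  fixes V :: "'a set" and E :: "'a \<Rightarrow> 'a \<Rightarrow> bool" and d :: nat and a b c :: "nat \<Rightarrow> nat"
  assumes dist_reg: "distance_regular V E d a b c"

sublocale distance_regular_graph \<subseteq> connected_simple_graph V E
  using dist_reg by unfold_locales (simp_all add: distance_regular_def)

context distance_regular_graph
begin

lemma finite_V: "finite V"
  and V_nonempty: "V \<noteq> {}"
  and dist_le_diameter: "x \<in> V \<Longrightarrow> y \<in> V \<Longrightarrow> dist x y \<le> d"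
  using dist_reg by (auto simp: distance_regular_def has_diameter_def)

lemma finite_sphere [simp]: "finite (sphere v i)"
  and finite_nbrs [simp]: "finite (nbrs v)"
  by (rule finite_subset[OF _ finite_V]; use edge_in_V in auto)+

lemma card_nbrs_closer:
  assumes "v \<in> V" "w \<in> V" "dist v w = i"
  shows "card (nbrs w \<inter> {u. dist v u + 1 = i}) = c i"
  using dist_reg assms dist_le_diameter[of v w]
  by (auto simp: distance_regular_def nbrs_def Collect_conj_eq)

lemma card_nbrs_sphere_Suc:
  assumes "v \<in> V" "w \<in> V" "dist v w = i"
  shows "card (nbrs w \<inter> sphere v (Suc i)) = b i"
proof -
  have "nbrs w \<inter> sphere v (Suc i) = {u. E w u \<and> dist v u = i + 1}"
    using edge_in_V by auto
  then show ?thesis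
    using dist_reg assms dist_le_diameter[of v w] by (auto simp: distance_regular_def)
qed

lemma card_nbrs_sphere_pred:
  assumes "v \<in> V" "w \<in> V" "dist v w = Suc i"
  shows "card (nbrs w \<inter> sphere v i) = c (Suc i)"
proof -
  have "nbrs w \<inter> sphere v i = nbrs w \<inter> {u. dist v u + 1 = Suc i}"
    using edge_in_V by auto
  then show ?thesis using card_nbrs_closer[OF assms] by simp
qed

lemma ex_pair_at_dist:
  assumes "i \<le> d"
  obtains x y where "x \<in> V" "y \<in> V" "dist x y = i"
proof -
  obtain x y where "x \<in> V" "y \<in> V" "dist x y = i + (d - i)"
    using dist_reg assms by (auto simp: distance_regular_def has_diameter_def)
  then show ?thesis using geodesic_point that by metis
qed

lemma
  assumes "i < d"
  shows b_pos: "0 < b i" and c_Suc_pos: "0 < c (Suc i)"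
proof -
  obtain v y where vy: "v \<in> V" "y \<in> V" "dist v y = i + 1"
    using ex_pair_at_dist[of "i + 1"] assms by auto
  then obtain x where x: "x \<in> V" "dist v x = i" "dist x y = 1"
    by (rule geodesic_point)
  then have "E x y" using vy edge_if_dist_eq_1 by simp
  then have "y \<in> nbrs x \<inter> sphere v (Suc i)" "x \<in> nbrs y \<inter> sphere v i"
    using vy x edge_sym by auto
  then have "0 < card (nbrs x \<inter> sphere v (Suc i))" "0 < card (nbrs y \<inter> sphere v i)"
    by (auto simp: card_gt_0_iff simp del: Int_iff)
  then show "0 < b i" "0 < c (Suc i)"
    using card_nbrs_sphere_Suc[of v x i] card_nbrs_sphere_pred[of v y i] vy x by simp_all
qed

lemma
  assumes "i \<le> j" "j \<le> d"
  shows b_antimono: "b j \<le> b i" and c_mono: "c i \<le> c j"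
proof -
  obtain v w where vw: "v \<in> V" "w \<in> V" "dist v w = (j - i) + i"
    using ex_pair_at_dist[of j] assms by auto
  then obtain v' where v': "v' \<in> V" "dist v v' = j - i" "dist v' w = i"
    by (rule geodesic_point)
  have triangle: "dist v u \<le> (j - i) + dist v' u" if "E w u" for u
    using dist_triangle[of v v' u] vw v' edge_in_V[OF that] by simp
  have "dist v' u = Suc i" if "E w u" "dist v u = Suc j" for u
    using triangle[OF that(1)] dist_edge_le[of v' w u] that v' \<open>i \<le> j\<close> by linarith
  then have "nbrs w \<inter> sphere v (Suc j) \<subseteq> nbrs w \<inter> sphere v' (Suc i)"
    by auto
  then have "card (nbrs w \<inter> sphere v (Suc j)) \<le> card (nbrs w \<inter> sphere v' (Suc i))"
    by (intro card_mono) auto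
  then show "b j \<le> b i"
    using card_nbrs_sphere_Suc[of v w j] card_nbrs_sphere_Suc[of v' w i] vw v' \<open>i \<le> j\<close> by simp
  have "dist v u + 1 = j" if "E w u" "dist v' u + 1 = i" for u
    using triangle[OF that(1)] dist_edge_le[of v u w] that vw edge_sym \<open>i \<le> j\<close> by fastforce
  then have "nbrs w \<inter> {u. dist v' u + 1 = i} \<subseteq> nbrs w \<inter> {u. dist v u + 1 = j}"
    by auto
  then have "card (nbrs w \<inter> {u. dist v' u + 1 = i}) \<le> card (nbrs w \<inter> {u. dist v u + 1 = j})"
    by (intro card_mono) auto
  then show "c i \<le> c j"
    using card_nbrs_closer[of v w j] card_nbrs_closer[of v' w i] vw v' \<open>i \<le> j\<close> by simp
qed

lemma card_sphere_inter_sphere_Suc: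
  assumes "u \<in> V" "v \<in> V" "dist u v = s"
  shows "card (sphere u (Suc t) \<inter> sphere v (s + Suc t)) * c (Suc t)
    = card (sphere u t \<inter> sphere v (s + t)) * b (s + t)"
proof -
  define layer where "layer i = sphere u i \<inter> sphere v (s + i)" for i
  have triangle: "dist v x \<le> s + dist u x" if "x \<in> V" for x
    using dist_triangle[of v u x] assms that dist_sym[of u v] by simp
  have "card (nbrs y \<inter> layer t) = c (Suc t)" if y: "y \<in> layer (Suc t)" for y
  proof -
    have "x \<in> layer t" if "x \<in> nbrs y \<inter> sphere u t" for x
      using that y triangle[of x] dist_edge_le[of v x y] edge_sym assms by (auto simp: layer_def)
    then have "nbrs y \<inter> layer t = nbrs y \<inter> sphere u t"
      by (auto simp: layer_def)
    then show ?thesis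
      using y card_nbrs_sphere_pred[of u y t] assms by (simp add: layer_def)
  qed
  moreover have "card (nbrs x \<inter> layer (Suc t)) = b (s + t)" if x: "x \<in> layer t" for x
  proof -
    have "y \<in> layer (Suc t)" if "y \<in> nbrs x \<inter> sphere v (Suc (s + t))" for y
      using that x triangle[of y] dist_edge_le[of u x y] assms by (auto simp: layer_def)
    then have "nbrs x \<inter> layer (Suc t) = nbrs x \<inter> sphere v (Suc (s + t))"
      by (auto simp: layer_def)
    then show ?thesis
      using x card_nbrs_sphere_Suc[of v x] assms by (simp add: layer_def)
  qed
  moreover have "(\<Sum>y\<in>layer (Suc t). card (nbrs y \<inter> layer t))
      = (\<Sum>x\<in>layer t. card (nbrs x \<inter> layer (Suc t)))"
    by (rule sum_card_nbrs_swap) (simp_all add: layer_def)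
  ultimately show ?thesis by (simp add: layer_def)
qed

text \<open>The intersection number commonly written \<open>p\<^sup>s\<^bsub>t,s+t\<^esub>\<close>.\<close>
definition extension_number :: "nat \<Rightarrow> nat \<Rightarrow> real" where
  "extension_number s t = (\<Prod>i<t. real (b (s + i)) / real (c (Suc i)))"

abbreviation valency :: "nat \<Rightarrow> real" where
  "valency \<equiv> extension_number 0"

lemma valency_Suc: "valency (Suc i) = valency i * (b i / c (Suc i))"
  by (simp add: extension_number_def)

lemma extension_number_pos: "s + t \<le> d \<Longrightarrow> 0 < extension_number s t"
  unfolding extension_number_def by (auto intro!: prod_pos divide_pos_pos b_pos c_Suc_pos)

lemma card_sphere_inter_sphere:
  assumes "u \<in> V" "v \<in> V" "dist u v = s" "s + t \<le> d"
  shows "real (card (sphere u t \<inter> sphere v (s + t))) = extension_number s t"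
  using \<open>s + t \<le> d\<close>
proof (induction t)
  case 0
  have "sphere u 0 \<inter> sphere v (s + 0) = {u}"
    using assms sphere_0[of u] dist_sym[of v u] by simp
  then show ?case by (simp add: extension_number_def)
next
  case (Suc t)
  have "real (card (sphere u (Suc t) \<inter> sphere v (s + Suc t))) * c (Suc t)
      = extension_number s t * b (s + t)"
    unfolding of_nat_mult[symmetric] card_sphere_inter_sphere_Suc[OF assms(1-3)]
    using Suc by simp
  then show ?case
    using c_Suc_pos[of t] Suc.prems by (simp add: extension_number_def field_simps)
qed

lemma card_sphere: "v \<in> V \<Longrightarrow> i \<le> d \<Longrightarrow> real (card (sphere v i)) = valency i"
  using card_sphere_inter_sphere[of v v 0 i] dist_eq_0[of v v] by simp

lemma valency_growth:
  assumes "i \<le> j" "j < d"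
  shows "b j / c (Suc j) * valency i \<le> valency (Suc i)"
proof -
  have "real (b j) / c (Suc j) \<le> b i / c (Suc i)"
    using assms b_antimono[of i j] c_mono[of "Suc i" "Suc j"] c_Suc_pos[of i]
    by (intro frac_le) auto
  then have "b j / c (Suc j) * valency i \<le> b i / c (Suc i) * valency i"
    using extension_number_pos[of 0 i] assms by (intro mult_right_mono) auto
  then show ?thesis by (simp add: valency_Suc mult.commute)
qed

definition recip_b_sum :: "nat \<Rightarrow> real" where
  "recip_b_sum s = (\<Sum>t = 1..s. 1 / real (b (t - 1)))"

lemma card_sphere_Suc_inter_le_if_nbrs_le:
  assumes "v \<in> V"
    and nbrs_le: "\<And>x. x \<in> V - Q \<Longrightarrow> card (nbrs x \<inter> Q) \<le> r"
  shows "card (sphere v (Suc s) \<inter> Q) * c (Suc s)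
    \<le> card (sphere v s \<inter> Q) * b s + card (sphere v s) * r"
proof -
  have "card (sphere v (Suc s) \<inter> Q) * c (Suc s)
      = (\<Sum>y\<in>sphere v (Suc s) \<inter> Q. card (nbrs y \<inter> sphere v s))"
    using card_nbrs_sphere_pred[of v _ s] \<open>v \<in> V\<close> by simp
  also have "\<dots> = (\<Sum>x\<in>sphere v s. card (nbrs x \<inter> (sphere v (Suc s) \<inter> Q)))"
    by (rule sum_card_nbrs_swap) auto
  also have "\<dots> \<le> (\<Sum>x\<in>sphere v s. (if x \<in> Q then b s else 0) + r)"
  proof (rule sum_mono)
    fix x assume x: "x \<in> sphere v s"
    have "card (nbrs x \<inter> (sphere v (Suc s) \<inter> Q)) \<le> card (nbrs x \<inter> sphere v (Suc s))"
      by (rule card_mono) auto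
    also have "\<dots> = b s"
      using x card_nbrs_sphere_Suc[of v x] \<open>v \<in> V\<close> by simp
    finally have farther: "card (nbrs x \<inter> (sphere v (Suc s) \<inter> Q)) \<le> b s" .
    have "card (nbrs x \<inter> (sphere v (Suc s) \<inter> Q)) \<le> card (nbrs x \<inter> Q)"
      by (rule card_mono) auto
    also have "\<dots> \<le> r" if "x \<notin> Q"
      using x that by (intro nbrs_le) simp
    finally show "card (nbrs x \<inter> (sphere v (Suc s) \<inter> Q)) \<le> (if x \<in> Q then b s else 0) + r"
      using farther by auto
  qed
  also have "\<dots> = card (sphere v s \<inter> Q) * b s + card (sphere v s) * r"
    by (simp add: sum.distrib sum.If_cases)
  finally show ?thesis .
qed

lemma card_sphere_inter_le_if_nbrs_le:
  assumes "v \<in> V - Q" "s \<le> d"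
    and nbrs_le: "\<And>x. x \<in> V - Q \<Longrightarrow> card (nbrs x \<inter> Q) \<le> r"
  shows "real (card (sphere v s \<inter> Q)) \<le> valency s * (r * recip_b_sum s)"
  using \<open>s \<le> d\<close>
proof (induction s)
  case 0
  have "sphere v 0 \<inter> Q = {}"
    using assms sphere_0 by auto
  then show ?case by (simp add: recip_b_sum_def)
next
  case (Suc s)
  have pos: "0 < b s" "0 < c (Suc s)"
    using b_pos c_Suc_pos Suc.prems by auto
  have "real (card (sphere v (Suc s) \<inter> Q) * c (Suc s))
      \<le> real (card (sphere v s \<inter> Q) * b s + card (sphere v s) * r)"
    using assms by (intro of_nat_mono card_sphere_Suc_inter_le_if_nbrs_le) auto
  also have "\<dots> = real (card (sphere v s \<inter> Q)) * b s + valency s * r"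
    using card_sphere[of v s] assms Suc.prems by simp
  also have "\<dots> \<le> valency s * (r * recip_b_sum s) * b s + valency s * r"
    using Suc by (intro add_mono mult_right_mono) auto
  also have "\<dots> = valency (Suc s) * (r * recip_b_sum (Suc s)) * c (Suc s)"
    using pos by (simp add: valency_Suc recip_b_sum_def field_simps)
  finally show ?case using pos by simp
qed

lemma card_nbrs_diff_ball_le:
  assumes "y \<in> V" "x \<in> ball y m"
  shows "card (nbrs x \<inter> (V - ball y m)) \<le> b m"
proof -
  have farther: "dist y x = m \<and> dist y u = Suc m" if "u \<in> nbrs x \<inter> (V - ball y m)" for u
    using that assms dist_edge_le[of y x u] by auto
  show ?thesis
  proof (cases "dist y x = m")
    case True
    have "nbrs x \<inter> (V - ball y m) \<subseteq> nbrs x \<inter> sphere y (Suc m)"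
      using farther by auto
    then show ?thesis
      using True card_nbrs_sphere_Suc[of y x] assms card_mono
      by (metis finite_Int finite_nbrs mem_ball)
  next
    case False
    then have "nbrs x \<inter> (V - ball y m) = {}" using farther by blast
    then show ?thesis by simp
  qed
qed

lemma card_nbrs_inter_ball_le:
  assumes "y \<in> V" "x \<in> V - ball y m"
  shows "card (nbrs x \<inter> ball y m) \<le> c (Suc m)"
proof -
  have closer: "dist y x = Suc m \<and> dist y u = m" if "u \<in> nbrs x \<inter> ball y m" for u
    using that assms dist_edge_le[of y u x] edge_sym[of x u] by auto
  show ?thesis
  proof (cases "dist y x = Suc m")
    case True
    have "nbrs x \<inter> ball y m \<subseteq> nbrs x \<inter> sphere y m"
      using closer by auto
    then show ?thesis
      using True card_nbrs_sphere_pred[of y x m] assms card_mono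
      by (metis DiffD1 finite_Int finite_nbrs)
  next
    case False
    then have "nbrs x \<inter> ball y m = {}" using closer by blast
    then show ?thesis by simp
  qed
qed

lemma sum_card_sphere_diff_ball_le:
  assumes "u \<in> V" "m \<le> d" "s \<le> d"
  shows "(\<Sum>v\<in>sphere u s. real (card (sphere u m - ball v m)))
    \<le> card (sphere u s) * (valency m * (b m * recip_b_sum s))"
proof -
  have eq_Collect: "sphere u m - ball v m = {z \<in> sphere u m. m < dist v z}" for v
    by auto
  have crossing: "real (card {v \<in> sphere u s. m < dist v z}) \<le> valency s * (b m * recip_b_sum s)"
    if z: "z \<in> sphere u m" for z
  proof -
    have "u \<in> V - (V - ball z m)"
      using z assms dist_sym[of u z] by simp
    moreover have "card (nbrs x \<inter> (V - ball z m)) \<le> b m" if "x \<in> V - (V - ball z m)" for x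
      using that z by (intro card_nbrs_diff_ball_le) auto
    ultimately have "real (card (sphere u s \<inter> (V - ball z m))) \<le> valency s * (b m * recip_b_sum s)"
      using assms by (intro card_sphere_inter_le_if_nbrs_le)
    moreover have "sphere u s \<inter> (V - ball z m) = {v \<in> sphere u s. m < dist v z}"
      using dist_sym[of z] by auto
    ultimately show ?thesis by simp
  qed
  have "(\<Sum>v\<in>sphere u s. real (card (sphere u m - ball v m)))
      = (\<Sum>z\<in>sphere u m. real (card {v \<in> sphere u s. m < dist v z}))"
    unfolding eq_Collect of_nat_sum[symmetric]
    by (intro arg_cong[of _ _ real] sum_multicount_gen) auto
  also have "\<dots> \<le> card (sphere u m) * (valency s * (b m * recip_b_sum s))"
    by (rule sum_bounded_above) (rule crossing)
  finally show ?thesis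
    using card_sphere assms by (simp add: mult_ac)
qed

lemma ex_opposite_pair:
  assumes "u \<in> V" "m \<le> d" "s + t \<le> d"
  shows "\<exists>v\<in>sphere u s. \<exists>w\<in>sphere u t. dist v w = s + t \<and>
    real (card (sphere u m - ball v m)) + real (card (sphere u m - ball w m))
      \<le> valency m * (b m * recip_b_sum s) + valency m * (b m * recip_b_sum t)"
proof (rule ex_le_average_of_biregular)
  show "sphere u s \<noteq> {}"
    using card_sphere[of u s] extension_number_pos[of 0 s] assms by force
  show "0 < extension_number s t"
    using assms by (intro extension_number_pos)
  show "real (card {w \<in> sphere u t. dist v w = s + t}) = extension_number s t"
    if "v \<in> sphere u s" for v
  proof -
    have "{w \<in> sphere u t. dist v w = s + t} = sphere u t \<inter> sphere v (s + t)" by auto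
    then show ?thesis using card_sphere_inter_sphere[of u v s t] that assms by simp
  qed
  show "real (card {v \<in> sphere u s. dist v w = s + t}) = extension_number t s"
    if "w \<in> sphere u t" for w
  proof -
    have "{v \<in> sphere u s. dist v w = s + t} = sphere u s \<inter> sphere w (t + s)"
      using dist_sym[of w] by auto
    then show ?thesis using card_sphere_inter_sphere[of u w t s] that assms by simp
  qed
qed (use assms sum_card_sphere_diff_ball_le in auto)

lemma card_sphere_inter_ball_le:
  assumes "v \<in> V" "w \<in> V" "dist v w = Suc m"
  shows "real (card (sphere v m \<inter> ball w m)) \<le> valency m * (c (Suc m) * recip_b_sum m)"
proof (rule card_sphere_inter_le_if_nbrs_le)
  show "v \<in> V - ball w m" using assms dist_sym[of v w] by simp
  show "m \<le> d" using assms dist_le_diameter[of v w] by simp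
qed (use assms card_nbrs_inter_ball_le in auto)

lemma card_sphere_le_via_balls:
  "card (sphere u m) \<le> card (sphere u m - ball v m) + card (sphere u m - ball w m)
    + (card (sphere v m \<inter> ball w m) + (\<Sum>l<m. card (sphere v l)))"
proof -
  have "sphere u m \<subseteq> ((sphere u m - ball v m) \<union> (sphere u m - ball w m))
      \<union> ((sphere v m \<inter> ball w m) \<union> (\<Union>l<m. sphere v l))"
    by auto
  then have "card (sphere u m) \<le> card (((sphere u m - ball v m) \<union> (sphere u m - ball w m))
      \<union> ((sphere v m \<inter> ball w m) \<union> (\<Union>l<m. sphere v l)))"
    by (intro card_mono) auto
  also have "\<dots> \<le> card (sphere u m - ball v m) + card (sphere u m - ball w m)
      + (card (sphere v m \<inter> ball w m) + card (\<Union>l<m. sphere v l))"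
    by (meson add_mono card_Un_le order_trans)
  also have "card (\<Union>l<m. sphere v l) \<le> (\<Sum>l<m. card (sphere v l))"
    by (rule card_UN_le) simp
  finally show ?thesis by simp
qed

lemma one_le_crossing_bounds:
  assumes "m < d" "s + t = Suc m"
  shows "1 \<le> b m * (recip_b_sum s + recip_b_sum t) + c (Suc m) * recip_b_sum m
    + (\<Sum>l<m. valency l) / valency m"
proof -
  obtain u where u: "u \<in> V" using V_nonempty by blast
  obtain v w where "v \<in> sphere u s" "w \<in> sphere u t" "dist v w = s + t"
    and leave: "real (card (sphere u m - ball v m)) + real (card (sphere u m - ball w m))
      \<le> valency m * (b m * recip_b_sum s) + valency m * (b m * recip_b_sum t)"
    using ex_opposite_pair[OF u, of m s t] assms by auto
  then have vw: "v \<in> V" "w \<in> V" "dist v w = Suc m" using assms by auto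
  have "valency m = card (sphere u m)"
    using card_sphere u assms by simp
  also have "\<dots> \<le> real (card (sphere u m - ball v m)) + real (card (sphere u m - ball w m))
      + (real (card (sphere v m \<inter> ball w m)) + (\<Sum>l<m. real (card (sphere v l))))"
    using of_nat_mono[OF card_sphere_le_via_balls[of u m v w]] by simp
  also have "(\<Sum>l<m. real (card (sphere v l))) = (\<Sum>l<m. valency l)"
    using card_sphere vw assms by simp
  finally have "valency m
      \<le> valency m * (b m * recip_b_sum s) + valency m * (b m * recip_b_sum t)
        + (valency m * (c (Suc m) * recip_b_sum m) + (\<Sum>l<m. valency l))"
    using leave card_sphere_inter_ball_le[OF vw] by linarith
  then show ?thesis
    using extension_number_pos[of 0 m] assms by (simp add: field_simps)
qed

lemma sum_valency_le:
  assumes "j < d" "c (Suc j) < b j"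
  shows "(\<Sum>l<Suc j. valency l) / valency (Suc j) \<le> 1 / (b j / c (Suc j) - 1)"
proof -
  define q where "q = real (b j) / c (Suc j)"
  have "1 < q" using assms c_Suc_pos[of j] by (simp add: q_def)
  have "(q - 1) * (\<Sum>l<Suc j. valency l) \<le> valency (Suc j) - valency 0"
    using valency_growth[of _ j] assms
    unfolding q_def by (intro sum_le_of_geometric_growth) simp
  also have "\<dots> \<le> valency (Suc j)"
    using extension_number_pos[of 0 0] by simp
  finally show ?thesis
    unfolding q_def[symmetric] using \<open>1 < q\<close> extension_number_pos[of 0 "Suc j"] assms
    by (simp add: field_simps)
qed

end

theorem theorem3p2:
  fixes V :: "'a set" and E :: "'a \<Rightarrow> 'a \<Rightarrow> bool"
    and d j s :: nat and a b c :: "nat \<Rightarrow> nat" and C :: real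
  assumes "distance_regular V E d a b c"
    and "d \<ge> 2"
    and "j \<le> d - 2"
    and "b j > c (j + 1)"
    and "C = real (b j) / real (c (j + 1))"
    and "1 \<le> s" and "s \<le> j + 1"
  shows "real (b (j + 1)) * ((\<Sum>t = 1..s. 1 / real (b (t - 1)))
            + (\<Sum>t = 1..j + 2 - s. 1 / real (b (t - 1))))
         + real (c (j + 2)) * (\<Sum>t = 1..j + 1. 1 / real (b (t - 1)))
         \<ge> 1 - 4 / (C - 1)"
proof -
  interpret distance_regular_graph V E d a b c
    by unfold_locales (rule assms(1))
  have "j + 1 < d" "s + (j + 2 - s) = Suc (j + 1)" using assms by auto
  then have "1 \<le> b (j + 1) * (recip_b_sum s + recip_b_sum (j + 2 - s))
      + c (j + 2) * recip_b_sum (j + 1) + (\<Sum>l<j + 1. valency l) / valency (j + 1)"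
    using one_le_crossing_bounds[of "j + 1" s "j + 2 - s"] by simp
  moreover have "(\<Sum>l<j + 1. valency l) / valency (j + 1) \<le> 1 / (C - 1)"
    using sum_valency_le[of j] assms \<open>j + 1 < d\<close> by simp
  moreover have "1 / (C - 1) \<le> 4 / (C - 1)"
    using assms c_Suc_pos[of j] \<open>j + 1 < d\<close> by (intro divide_right_mono) auto
  ultimately show ?thesis
    unfolding recip_b_sum_def by linarith
qed

end
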